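(* Let $m\ge2$, $\rho\in(-1,1)\setminus\{0\}$, and let $(X_{i1},X_{i2})$, $1\le i\le m$, be independent bivariate Gaussian random vectors with $N(0,1)$ distributed marginals and correlation coefficient $\rho$. Set $\zeta_1=\sum_{i=1}^mX_{i1}^2$ and $\zeta_2=\sum_{i=1}^mX_{i2}^2$. For $v>0$ let $\zeta_v^*$ be a random variable having the conditional distribution $$\zeta_v^*:=\frac{\zeta_2-\rho^2v}{2\rho\sqrt{(1-\rho^2)v}}\,\Big|\,(\zeta_1=v),$$ and let $W$ be a standard Gaussian random variable. Then $$\lim_{v\to\infty}\sup_{x\in\mathbb{R}}\left|\mathbb{P}\{\zeta_v^*\le x\}-\mathbb{P}\{W\le x\}\right|=0.$$
   Context: The notation $Y\,|\,(\zeta_1=v)$ denotes a random variable whose law is the conditional law of $Y$ given $\zeta_1=v$. *)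

theory Defs
  imports "HOL-Probability.Probability"
begin

text \<open>Jointly Gaussian pair: an affine image of two independent standard Gaussians. Degenerate laws
  are included.\<close>

definition bivariate_gaussian :: "'a measure \<Rightarrow> ('a \<Rightarrow> real \<times> real) \<Rightarrow> bool" where
  "bivariate_gaussian M V \<longleftrightarrow>
     V \<in> borel_measurable M \<and>
     (\<exists>\<mu>\<^sub>1 \<mu>\<^sub>2 a b c d :: real.
        distr M borel V =
        distr (std_normal_distribution \<Otimes>\<^sub>M std_normal_distribution) borel
          (\<lambda>(z, w). (\<mu>\<^sub>1 + a * z + b * w, \<mu>\<^sub>2 + c * z + d * w)))"

definition standard_gaussian :: "'a measure \<Rightarrow> ('a \<Rightarrow> real) \<Rightarrow> bool" where
  "standard_gaussian M U \<longleftrightarrow> distributed M lborel U std_normal_density"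

definition covariance :: "'a measure \<Rightarrow> ('a \<Rightarrow> real) \<Rightarrow> ('a \<Rightarrow> real) \<Rightarrow> real" where
  "covariance M U V =
     (\<integral>\<omega>. (U \<omega> - (\<integral>\<omega>'. U \<omega>' \<partial>M)) * (V \<omega> - (\<integral>\<omega>'. V \<omega>' \<partial>M)) \<partial>M)"

definition correlation :: "'a measure \<Rightarrow> ('a \<Rightarrow> real) \<Rightarrow> ('a \<Rightarrow> real) \<Rightarrow> real" where
  "correlation M U V = covariance M U V / (sqrt (covariance M U U) * sqrt (covariance M V V))"

definition regular_cond_distr ::
    "'a measure \<Rightarrow> ('a \<Rightarrow> real) \<Rightarrow> ('a \<Rightarrow> real) \<Rightarrow> (real \<Rightarrow> real measure) \<Rightarrow> bool" where
  "regular_cond_distr M Y Z \<kappa> \<longleftrightarrow>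
     \<kappa> \<in> borel \<rightarrow>\<^sub>M prob_algebra borel \<and>
     (\<forall>A\<in>sets borel. \<forall>B\<in>sets borel.
        emeasure M {\<omega> \<in> space M. Z \<omega> \<in> A \<and> Y \<omega> \<in> B} =
        (\<integral>\<^sup>+z\<in>A. emeasure (\<kappa> z) B \<partial>distr M borel Z))"

text \<open>A regular conditional distribution is determined only up to null sets of the law of \<open>Z\<close>, so
  the law of \<open>Y\<close> given \<open>Z = v\<close> at a single point \<open>v\<close> is taken from a version that is
  weakly continuous at \<open>v\<close>. If \<open>v\<close> lies in the support of the law of \<open>Z\<close>, any two such
  versions agree at \<open>v\<close>: they agree along some sequence tending to \<open>v\<close>.\<close>

definition is_cond_law ::
    "'a measure \<Rightarrow> ('a \<Rightarrow> real) \<Rightarrow> ('a \<Rightarrow> real) \<Rightarrow> real \<Rightarrow> real measure \<Rightarrow> bool" where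
  "is_cond_law M Y Z v \<nu> \<longleftrightarrow>
     (\<forall>\<epsilon>>0. measure M {\<omega> \<in> space M. \<bar>Z \<omega> - v\<bar> < \<epsilon>} > 0) \<and>
     (\<exists>\<kappa>. regular_cond_distr M Y Z \<kappa> \<and>
          (\<forall>s. s \<longlonglongrightarrow> v \<longrightarrow> weak_conv_m (\<lambda>n. \<kappa> (s n)) (\<kappa> v)) \<and>
          \<nu> = \<kappa> v)"

definition cond_law ::
    "'a measure \<Rightarrow> ('a \<Rightarrow> real) \<Rightarrow> ('a \<Rightarrow> real) \<Rightarrow> real \<Rightarrow> real measure" where
  "cond_law M Y Z v = (THE \<nu>. is_cond_law M Y Z v \<nu>)"

end

theory Submission
  imports Defs
begin

text \<open>Write \<open>s = sqrt (1 - \<rho>\<^sup>2)\<close>. Each pair has the law of \<open>(x\<^sub>i, \<rho> x\<^sub>i + s h\<^sub>i)\<close> with all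
  \<open>x\<^sub>i\<close>, \<open>h\<^sub>i\<close> independent standard normal (\<open>correlated_gaussian_law\<close>), so that
  \<open>\<zeta>\<^sub>2 = \<rho>\<^sup>2 |x|\<^sup>2 + 2 \<rho> s \<langle>x, h\<rangle> + s\<^sup>2 |h|\<^sup>2\<close>. As the law of \<open>h\<close> is rotation invariant, the
  direction of \<open>x\<close> is irrelevant: given \<open>|x|\<^sup>2 = c\<close>, the pair \<open>(\<langle>x, h\<rangle>, |h|\<^sup>2)\<close> is distributed as
  \<open>(sqrt c g, g\<^sup>2 + q)\<close> with \<open>g\<close> standard normal and \<open>q\<close> an independent chi-square variable with
  \<open>m - 1\<close> degrees of freedom. This is \<open>nn_integral_sum_squares_regression\<close>. It is proved by
  induction on the number of summands, where adding a summand takes one rotation of the plane.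

  The resulting conditional law of \<open>\<zeta>\<^sub>2\<close> depends continuously on \<open>c\<close>, and every \<open>v > 0\<close> lies in
  the support of \<open>\<zeta>\<^sub>1\<close>; hence it gives the conditional law at the point \<open>v\<close>
  (\<open>cond_law_regression_kernel\<close>, whose uniqueness part is \<open>is_cond_law_unique\<close>). At \<open>c = v\<close> the
  standardisation cancels \<open>\<rho>\<^sup>2 v\<close> and turns the linear term into \<open>g\<close>, so
  \<open>\<zeta>\<^sub>v\<close> has the law of \<open>g + s / (2 \<rho> sqrt v) (g\<^sup>2 + q)\<close>. The second term is a fixed random variable times a factor that tends to zero. Since the normal
  distribution function is Lipschitz continuous, such a perturbation changes the distribution
  function of \<open>g\<close> by an amount that tends to zero uniformly
  (\<open>std_normal_perturbation_uniform\<close>).\<close>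

section \<open>Rotation invariance of the standard normal law\<close>

abbreviation std_normal :: "real measure" where
  "std_normal \<equiv> std_normal_distribution"

interpretation std_normal: real_distribution std_normal
  by (rule real_dist_normal_dist)

interpretation std_normal_pair: pair_sigma_finite std_normal std_normal ..

lemma measurable_real_pair [measurable]:
  "fst \<in> borel_measurable (borel :: (real \<times> real) measure)"
  "snd \<in> borel_measurable (borel :: (real \<times> real) measure)"
  by (auto intro!: borel_measurable_continuous_onI continuous_intros)

text \<open>A rotation with \<open>a \<noteq> 0\<close> is a composition of two maps that each change one coordinate by an
  affine substitution, with Jacobians \<open>1 / a\<close> and \<open>a\<close>; a quarter turn is a swap and a reflection.\<close>
lemma nn_integral_lborel_rotate:
  fixes G :: "real \<times> real \<Rightarrow> ennreal" and a b :: real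
  assumes [measurable]: "G \<in> borel_measurable borel" and ab: "a\<^sup>2 + b\<^sup>2 = 1"
  shows "(\<integral>\<^sup>+x. \<integral>\<^sup>+y. G (a * x + b * y, a * y - b * x) \<partial>lborel \<partial>lborel) =
    (\<integral>\<^sup>+x. \<integral>\<^sup>+y. G (x, y) \<partial>lborel \<partial>lborel)"
proof (cases "a = 0")
  case False
  have "(\<integral>\<^sup>+x. \<integral>\<^sup>+y. G (a * x + b * y, a * y - b * x) \<partial>lborel \<partial>lborel) =
      (\<integral>\<^sup>+y. \<integral>\<^sup>+x. G (a * x + b * y, a * y - b * x) \<partial>lborel \<partial>lborel)"
    by (rule lborel_pair.Fubini'[symmetric]) measurable
  also have "\<dots> = (\<integral>\<^sup>+y. \<bar>1 / a\<bar> * (\<integral>\<^sup>+u. G (u, - (b / a) * u + (1 / a) * y) \<partial>lborel) \<partial>lborel)"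
  proof (intro nn_integral_cong)
    fix y
    have *: "a * (- (b / a) * y + (1 / a) * u) + b * y = u"
      "a * y - b * (- (b / a) * y + (1 / a) * u) = - (b / a) * u + (1 / a) * y" for u
    proof -
      show "a * (- (b / a) * y + (1 / a) * u) + b * y = u"
        using False by (simp add: field_simps)
      have "a * y - b * (- (b / a) * y + (1 / a) * u) = ((a\<^sup>2 + b\<^sup>2) * y - b * u) / a"
        using False by (simp add: field_simps power2_eq_square)
      then show "a * y - b * (- (b / a) * y + (1 / a) * u) = - (b / a) * u + (1 / a) * y"
        by (simp add: ab diff_divide_distrib)
    qed
    show "(\<integral>\<^sup>+x. G (a * x + b * y, a * y - b * x) \<partial>lborel) =
        \<bar>1 / a\<bar> * (\<integral>\<^sup>+u. G (u, - (b / a) * u + (1 / a) * y) \<partial>lborel)"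
      using False by (subst nn_integral_real_affine[where c="1 / a" and t="- (b / a) * y"]) (simp_all only: *, simp_all)
  qed
  also have "\<dots> = \<bar>1 / a\<bar> * (\<integral>\<^sup>+y. \<integral>\<^sup>+u. G (u, - (b / a) * u + (1 / a) * y) \<partial>lborel \<partial>lborel)"
    by (rule nn_integral_cmult) measurable
  also have "(\<integral>\<^sup>+y. \<integral>\<^sup>+u. G (u, - (b / a) * u + (1 / a) * y) \<partial>lborel \<partial>lborel) =
      (\<integral>\<^sup>+u. \<integral>\<^sup>+y. G (u, - (b / a) * u + (1 / a) * y) \<partial>lborel \<partial>lborel)"
    by (rule lborel_pair.Fubini') measurable
  also have "\<bar>1 / a\<bar> * \<dots> = (\<integral>\<^sup>+u. \<bar>1 / a\<bar> * (\<integral>\<^sup>+y. G (u, - (b / a) * u + (1 / a) * y) \<partial>lborel) \<partial>lborel)"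
    by (rule nn_integral_cmult[symmetric]) measurable
  also have "\<dots> = (\<integral>\<^sup>+u. \<integral>\<^sup>+y. G (u, y) \<partial>lborel \<partial>lborel)"
    using False by (intro nn_integral_cong nn_integral_real_affine[symmetric]) auto
  finally show ?thesis .
next
  case True
  with ab have b: "\<bar>b\<bar> = 1" "b \<noteq> 0" by (auto simp: power2_eq_1_iff)
  have "(\<integral>\<^sup>+x. \<integral>\<^sup>+y. G (b * y, - b * x) \<partial>lborel \<partial>lborel) = (\<integral>\<^sup>+x. \<integral>\<^sup>+y. G (y, - b * x) \<partial>lborel \<partial>lborel)"
    using b nn_integral_real_affine[of "\<lambda>y. G (y, - b * x)" b 0 for x] by simp
  also have "\<dots> = (\<integral>\<^sup>+y. \<integral>\<^sup>+x. G (y, - b * x) \<partial>lborel \<partial>lborel)"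
    by (rule lborel_pair.Fubini') measurable
  also have "\<dots> = (\<integral>\<^sup>+y. \<integral>\<^sup>+x. G (y, x) \<partial>lborel \<partial>lborel)"
    using b nn_integral_real_affine[of "\<lambda>x. G (y, x)" "- b" 0 for y] by simp
  finally show ?thesis using True by simp
qed

text \<open>The product density depends on the point only through its distance to the origin.\<close>
lemma nn_integral_std_normal_rotate:
  fixes F :: "real \<times> real \<Rightarrow> ennreal"
  assumes [measurable]: "F \<in> borel_measurable borel" and ab: "a\<^sup>2 + b\<^sup>2 = 1"
  shows "(\<integral>\<^sup>+x. \<integral>\<^sup>+y. F (a * x + b * y, a * y - b * x) \<partial>std_normal \<partial>std_normal) =
    (\<integral>\<^sup>+x. \<integral>\<^sup>+y. F (x, y) \<partial>std_normal \<partial>std_normal)"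
proof -
  let ?d = "\<lambda>x. ennreal (std_normal_density x)"
  have dens: "(\<integral>\<^sup>+x. \<integral>\<^sup>+y. K (x, y) \<partial>std_normal \<partial>std_normal) =
      (\<integral>\<^sup>+x. \<integral>\<^sup>+y. ?d x * ?d y * K (x, y) \<partial>lborel \<partial>lborel)"
    if [measurable]: "K \<in> borel_measurable borel" for K :: "real \<times> real \<Rightarrow> ennreal"
    by (simp add: nn_integral_density nn_integral_cmult[symmetric] mult.assoc)
  have radial: "?d (a * x + b * y) * ?d (a * y - b * x) = ?d x * ?d y" for x y
  proof -
    have "(a * x + b * y)\<^sup>2 + (a * y - b * x)\<^sup>2 = (a\<^sup>2 + b\<^sup>2) * (x\<^sup>2 + y\<^sup>2)" by algebra
    then have "- (a * x + b * y)\<^sup>2 / 2 + - (a * y - b * x)\<^sup>2 / 2 = - x\<^sup>2 / 2 + - y\<^sup>2 / 2"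
      using ab by simp
    then have "exp (- (a * x + b * y)\<^sup>2 / 2) * exp (- (a * y - b * x)\<^sup>2 / 2) =
        exp (- x\<^sup>2 / 2) * exp (- y\<^sup>2 / 2)"
      unfolding exp_add[symmetric] by simp
    then have "std_normal_density (a * x + b * y) * std_normal_density (a * y - b * x) =
        std_normal_density x * std_normal_density y"
      by (simp add: std_normal_density_def)
    then show ?thesis by (simp add: ennreal_mult'[symmetric])
  qed
  have "(\<integral>\<^sup>+x. \<integral>\<^sup>+y. F (a * x + b * y, a * y - b * x) \<partial>std_normal \<partial>std_normal) =
      (\<integral>\<^sup>+x. \<integral>\<^sup>+y. ?d x * ?d y * F (a * x + b * y, a * y - b * x) \<partial>lborel \<partial>lborel)"
    using dens[of "\<lambda>p. F (a * fst p + b * snd p, a * snd p - b * fst p)"] by simp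
  also have "\<dots> = (\<integral>\<^sup>+x. \<integral>\<^sup>+y. (\<lambda>(u, w). ?d u * ?d w * F (u, w)) (a * x + b * y, a * y - b * x)
      \<partial>lborel \<partial>lborel)"
    by (simp add: radial)
  also have "\<dots> = (\<integral>\<^sup>+x. \<integral>\<^sup>+y. ?d x * ?d y * F (x, y) \<partial>lborel \<partial>lborel)"
    by (subst nn_integral_lborel_rotate) (use ab in simp_all)
  finally show ?thesis by (simp add: dens)
qed

text \<open>The quarter turns, applied to a function of one coordinate.\<close>
lemma nn_integral_std_normal_reflect:
  fixes F :: "real \<Rightarrow> ennreal"
  assumes [measurable]: "F \<in> borel_measurable borel" and b: "\<bar>b\<bar> = 1"
  shows "(\<integral>\<^sup>+x. F (b * x) \<partial>std_normal) = (\<integral>\<^sup>+x. F x \<partial>std_normal)"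
  using nn_integral_std_normal_rotate[of "\<lambda>p. F (fst p)" 0 b] b std_normal.emeasure_space_1
  by (auto simp: abs_if split: if_splits)

section \<open>Chi-square laws\<close>
primrec chi_square :: "nat \<Rightarrow> real measure" where
  "chi_square 0 = return borel 0"
| "chi_square (Suc n) = distr (chi_square n \<Otimes>\<^sub>M std_normal) borel (\<lambda>(c, x). c + x\<^sup>2)"

lemma real_distribution_chi_square: "real_distribution (chi_square n)"
proof (induction n)
  case 0
  show ?case
    by (simp add: real_distribution_def real_distribution_axioms_def prob_space_return)
next
  case (Suc n)
  interpret real_distribution "chi_square n" by fact
  interpret pair_prob_space "chi_square n" std_normal ..
  show ?case by simp
qed

interpretation chi_square: real_distribution "chi_square n" for n
  by (rule real_distribution_chi_square)

lemma nn_integral_chi_square_0 [simp]: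
  assumes [measurable]: "f \<in> borel_measurable borel"
  shows "(\<integral>\<^sup>+c. f c \<partial>chi_square 0) = f 0"
  by (simp add: nn_integral_return)

lemma nn_integral_chi_square_Suc:
  assumes [measurable]: "f \<in> borel_measurable borel"
  shows "(\<integral>\<^sup>+c. f c \<partial>chi_square (Suc n)) = (\<integral>\<^sup>+c. \<integral>\<^sup>+x. f (c + x\<^sup>2) \<partial>std_normal \<partial>chi_square n)"
  by (simp add: nn_integral_distr std_normal.nn_integral_fst[symmetric] split_beta')

text \<open>The law is carried by the nonnegative half-line. In this form the fact passes through iterated
  integrals as an equation, without exceptional null sets.\<close>
lemma nn_integral_chi_square_abs:
  assumes "f \<in> borel_measurable borel"
  shows "(\<integral>\<^sup>+c. f c \<partial>chi_square n) = (\<integral>\<^sup>+c. f \<bar>c\<bar> \<partial>chi_square n)"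
  using assms
proof (induction n arbitrary: f)
  case 0
  note [measurable] = 0
  show ?case by (simp del: chi_square.simps)
next
  case (Suc n)
  note [measurable] = Suc.prems
  let ?g = "\<lambda>f c. \<integral>\<^sup>+x. f (c + x\<^sup>2) \<partial>std_normal"
  have "(\<integral>\<^sup>+c. ?g f c \<partial>chi_square n) = (\<integral>\<^sup>+c. ?g f \<bar>c\<bar> \<partial>chi_square n)"
    by (rule Suc.IH) measurable
  also have "\<dots> = (\<integral>\<^sup>+c. ?g (\<lambda>c. f \<bar>c\<bar>) \<bar>c\<bar> \<partial>chi_square n)" by simp
  also have "\<dots> = (\<integral>\<^sup>+c. ?g (\<lambda>c. f \<bar>c\<bar>) c \<partial>chi_square n)"
    by (rule Suc.IH[symmetric]) measurable
  finally show ?case by (simp add: nn_integral_chi_square_Suc del: chi_square.simps)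
qed

section \<open>Joint law of the two sums of squares\<close>
definition regression_pair :: "real \<Rightarrow> real \<Rightarrow> (real \<times> real) measure" where
  "regression_pair \<rho> s = distr (std_normal \<Otimes>\<^sub>M std_normal) borel (\<lambda>(x, h). (x, \<rho> * x + s * h))"

lemma sets_regression_pair [simp, measurable_cong]: "sets (regression_pair \<rho> s) = sets borel"
  by (simp add: regression_pair_def)

lemma prob_space_regression_pair: "prob_space (regression_pair \<rho> s)"
proof -
  interpret pair_prob_space std_normal std_normal ..
  show ?thesis unfolding regression_pair_def by (rule prob_space_distr) measurable
qed

lemma nn_integral_regression_pair:
  assumes [measurable]: "f \<in> borel_measurable borel"
  shows "(\<integral>\<^sup>+y. f y \<partial>regression_pair \<rho> s) =
    (\<integral>\<^sup>+x. \<integral>\<^sup>+h. f (x, \<rho> * x + s * h) \<partial>std_normal \<partial>std_normal)"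
  by (simp add: regression_pair_def nn_integral_distr std_normal.nn_integral_fst[symmetric] split_beta')

text \<open>The value of \<open>|\<rho> x + s h|\<^sup>2\<close> for vectors with \<open>|x|\<^sup>2 = c\<close>, where \<open>g\<close> is the component of \<open>h\<close>
  along \<open>x\<close> and \<open>q\<close> the squared length of the remaining part of \<open>h\<close>.\<close>
definition regression_square :: "real \<Rightarrow> real \<Rightarrow> real \<Rightarrow> real \<Rightarrow> real \<Rightarrow> real" where
  "regression_square \<rho> s c g q = \<rho>\<^sup>2 * c + 2 * \<rho> * s * sqrt c * g + s\<^sup>2 * (g\<^sup>2 + q)"

lemma measurable_regression_square [measurable (raw)]:
  assumes [measurable]: "f \<in> borel_measurable M" "g \<in> borel_measurable M" "h \<in> borel_measurable M"
  shows "(\<lambda>x. regression_square \<rho> s (f x) (g x) (h x)) \<in> borel_measurable M"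
  unfolding regression_square_def by measurable

text \<open>The induction step. Adding a coordinate \<open>x\<close> to a vector of squared length \<open>c\<close> moves the
  distinguished direction in the plane spanned by the old direction and the new axis. In that plane
  the Gaussian vector has coordinates \<open>(g, h)\<close>, and rotating by the angle with cosine
  \<open>sqrt c / sqrt (c + x\<^sup>2)\<close> splits it into the component along the new vector and one orthogonal
  to it, whose square joins \<open>q\<close>.\<close>
lemma add_pair_rotate:
  fixes f :: "real \<times> real \<Rightarrow> ennreal"
  assumes [measurable]: "f \<in> borel_measurable borel" and c: "c \<ge> 0"
  shows "(\<integral>\<^sup>+g. \<integral>\<^sup>+h. f (c + x\<^sup>2, regression_square \<rho> s c g q + (\<rho> * x + s * h)\<^sup>2)
      \<partial>std_normal \<partial>std_normal) =
    (\<integral>\<^sup>+g. \<integral>\<^sup>+h. f (c + x\<^sup>2, regression_square \<rho> s (c + x\<^sup>2) g (q + h\<^sup>2))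
      \<partial>std_normal \<partial>std_normal)"
proof (cases "c + x\<^sup>2 = 0")
  case True
  then have "c = 0" "x = 0" using c by (auto simp: add_nonneg_eq_0_iff)
  then show ?thesis by (simp add: regression_square_def algebra_simps)
next
  case False
  define r where "r = sqrt (c + x\<^sup>2)"
  have r: "r > 0" "r\<^sup>2 = c + x\<^sup>2" using False c by (auto simp: r_def less_le)
  have sq: "(sqrt c)\<^sup>2 = c" using c by simp
  define a b where "a = sqrt c / r" and "b = x / r"
  have ab: "a\<^sup>2 + b\<^sup>2 = 1"
    using r sq False by (simp add: a_def b_def power_divide add_divide_distrib[symmetric])
  have ra: "r * a = sqrt c" and rb: "r * b = x" using r by (auto simp: a_def b_def)
  have "regression_square \<rho> s (c + x\<^sup>2) (a * g + b * h) (q + (a * h - b * g)\<^sup>2) =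
      regression_square \<rho> s c g q + (\<rho> * x + s * h)\<^sup>2" for g h
  proof -
    have 1: "sqrt (c + x\<^sup>2) * (a * g + b * h) = sqrt c * g + x * h"
      using ra rb r_def by (metis distrib_left mult.assoc)
    have "(a * g + b * h)\<^sup>2 + (a * h - b * g)\<^sup>2 = (a\<^sup>2 + b\<^sup>2) * (g\<^sup>2 + h\<^sup>2)" by algebra
    then have 2: "(a * g + b * h)\<^sup>2 + (a * h - b * g)\<^sup>2 = g\<^sup>2 + h\<^sup>2" using ab by simp
    have "regression_square \<rho> s (c + x\<^sup>2) (a * g + b * h) (q + (a * h - b * g)\<^sup>2) =
        \<rho>\<^sup>2 * (c + x\<^sup>2) + 2 * \<rho> * s * (sqrt (c + x\<^sup>2) * (a * g + b * h)) +
        s\<^sup>2 * (((a * g + b * h)\<^sup>2 + (a * h - b * g)\<^sup>2) + q)"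
      unfolding regression_square_def by (simp add: algebra_simps)
    also have "\<dots> = regression_square \<rho> s c g q + (\<rho> * x + s * h)\<^sup>2"
      unfolding 1 2 regression_square_def by (simp add: algebra_simps power2_eq_square)
    finally show ?thesis .
  qed
  then show ?thesis
    using nn_integral_std_normal_rotate[of
        "\<lambda>p. f (c + x\<^sup>2, regression_square \<rho> s (c + x\<^sup>2) (fst p) (q + (snd p)\<^sup>2))" a b] ab
    by simp
qed

lemma nn_integral_chi_square_cong:
  assumes [measurable]: "f \<in> borel_measurable borel" "g \<in> borel_measurable borel"
    and "\<And>c. c \<ge> 0 \<Longrightarrow> f c = g c"
  shows "(\<integral>\<^sup>+c. f c \<partial>chi_square n) = (\<integral>\<^sup>+c. g c \<partial>chi_square n)"
  using nn_integral_chi_square_abs[of f n] nn_integral_chi_square_abs[of g n] assms(3) by simp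

lemma nn_integral_Fubini_real:
  fixes f :: "real \<Rightarrow> real \<Rightarrow> ennreal"
  assumes "real_distribution M" "real_distribution N"
    and f: "(\<lambda>p. f (fst p) (snd p)) \<in> borel_measurable (borel \<Otimes>\<^sub>M borel)"
  shows "(\<integral>\<^sup>+x. \<integral>\<^sup>+y. f x y \<partial>N \<partial>M) = (\<integral>\<^sup>+y. \<integral>\<^sup>+x. f x y \<partial>M \<partial>N)"
proof -
  interpret M: real_distribution M by fact
  interpret N: real_distribution N by fact
  interpret pair_sigma_finite N M ..
  have "(\<lambda>(y, x). f x y) \<in> borel_measurable (borel \<Otimes>\<^sub>M borel)"
    using measurable_pair_swap[OF f] by (simp add: split_beta')
  also have "borel_measurable (borel \<Otimes>\<^sub>M borel) = borel_measurable (N \<Otimes>\<^sub>M M)"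
    by (intro measurable_cong_sets sets_pair_measure_cong) simp_all
  finally show ?thesis by (rule Fubini')
qed

text \<open>The remainder has one degree of freedom less than \<open>c\<close>, because the direction along \<open>x\<close> is
  split off. A single summand is the case without remainder: there \<open>x = \<plusminus> sqrt c\<close> and the sign is
  absorbed by the symmetry of \<open>h\<close>.\<close>
lemma nn_integral_sum_squares_regression:
  fixes f :: "real \<times> real \<Rightarrow> ennreal"
  assumes "finite J" "J \<noteq> {}" "f \<in> borel_measurable borel"
  shows "(\<integral>\<^sup>+p. f (\<Sum>i\<in>J. (fst (p i))\<^sup>2, \<Sum>i\<in>J. (snd (p i))\<^sup>2) \<partial>Pi\<^sub>M J (\<lambda>_. regression_pair \<rho> s)) =
    (\<integral>\<^sup>+c. \<integral>\<^sup>+g. \<integral>\<^sup>+q. f (c, regression_square \<rho> s c g q)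
      \<partial>chi_square (card J - 1) \<partial>std_normal \<partial>chi_square (card J))"
  using assms
proof (induction J arbitrary: f rule: finite_ne_induct)
  case (singleton i)
  note [measurable] = singleton
  interpret product_sigma_finite "\<lambda>_. regression_pair \<rho> s"
    by (simp add: product_sigma_finite_def prob_space_imp_sigma_finite prob_space_regression_pair)
  have "(\<integral>\<^sup>+p. f ((fst (p i))\<^sup>2, (snd (p i))\<^sup>2) \<partial>Pi\<^sub>M {i} (\<lambda>_. regression_pair \<rho> s)) =
      (\<integral>\<^sup>+x. \<integral>\<^sup>+h. f (x\<^sup>2, (\<rho> * x + s * h)\<^sup>2) \<partial>std_normal \<partial>std_normal)"
    by (subst product_nn_integral_singleton[of "\<lambda>y. f ((fst y)\<^sup>2, (snd y)\<^sup>2)"])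
      (simp_all add: nn_integral_regression_pair)
  also have "\<dots> = (\<integral>\<^sup>+x. \<integral>\<^sup>+g. f (x\<^sup>2, regression_square \<rho> s (x\<^sup>2) g 0) \<partial>std_normal \<partial>std_normal)"
  proof (rule nn_integral_cong)
    fix x :: real
    define b where "b = (if x \<ge> 0 then 1 else - 1 :: real)"
    have "regression_square \<rho> s (x\<^sup>2) (b * h) 0 = (\<rho> * x + s * h)\<^sup>2" for h
      by (simp add: regression_square_def b_def power2_eq_square algebra_simps)
    then show "(\<integral>\<^sup>+h. f (x\<^sup>2, (\<rho> * x + s * h)\<^sup>2) \<partial>std_normal) =
        (\<integral>\<^sup>+g. f (x\<^sup>2, regression_square \<rho> s (x\<^sup>2) g 0) \<partial>std_normal)"
      using nn_integral_std_normal_reflect[of "\<lambda>g. f (x\<^sup>2, regression_square \<rho> s (x\<^sup>2) g 0)" b]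
      by (simp add: b_def)
  qed
  finally show ?case
    by (simp add: nn_integral_chi_square_Suc del: chi_square.simps)
next
  case (insert i J)
  note [measurable] = insert.prems
  note Fub = nn_integral_Fubini_real[OF real_distribution_chi_square real_dist_normal_dist]
    nn_integral_Fubini_real[OF real_dist_normal_dist real_distribution_chi_square]
    nn_integral_Fubini_real[OF real_dist_normal_dist real_dist_normal_dist]
  interpret product_sigma_finite "\<lambda>_. regression_pair \<rho> s"
    by (simp add: product_sigma_finite_def prob_space_imp_sigma_finite prob_space_regression_pair)
  obtain n where n: "card J = Suc n"
    using insert.hyps by (metis card_gt_0_iff gr0_conv_Suc)
  let ?k = "\<lambda>(z, t). \<integral>\<^sup>+x. \<integral>\<^sup>+h. f (z + x\<^sup>2, t + (\<rho> * x + s * h)\<^sup>2) \<partial>std_normal \<partial>std_normal"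
  have "(\<integral>\<^sup>+p. f (\<Sum>i\<in>insert i J. (fst (p i))\<^sup>2, \<Sum>i\<in>insert i J. (snd (p i))\<^sup>2)
        \<partial>Pi\<^sub>M (insert i J) (\<lambda>_. regression_pair \<rho> s)) =
      (\<integral>\<^sup>+p. (\<integral>\<^sup>+y. f ((\<Sum>j\<in>J. (fst (p j))\<^sup>2) + (fst y)\<^sup>2, (\<Sum>j\<in>J. (snd (p j))\<^sup>2) + (snd y)\<^sup>2)
        \<partial>regression_pair \<rho> s) \<partial>Pi\<^sub>M J (\<lambda>_. regression_pair \<rho> s))"
  proof -
    have "(\<Sum>j\<in>J. g ((p(i := y)) j)) = (\<Sum>j\<in>J. g (p j))" for g :: "real \<times> real \<Rightarrow> real" and p y
      using insert.hyps by (intro sum.cong) auto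
    from this[of "\<lambda>y. (fst y)\<^sup>2"] this[of "\<lambda>y. (snd y)\<^sup>2"] show ?thesis
      using insert.hyps
      by (subst product_nn_integral_insert) (simp_all add: add.commute)
  qed
  also have "\<dots> = (\<integral>\<^sup>+p. ?k (\<Sum>i\<in>J. (fst (p i))\<^sup>2, \<Sum>i\<in>J. (snd (p i))\<^sup>2) \<partial>Pi\<^sub>M J (\<lambda>_. regression_pair \<rho> s))"
    by (simp add: nn_integral_regression_pair)
  also have "\<dots> = (\<integral>\<^sup>+c. \<integral>\<^sup>+g. \<integral>\<^sup>+q. ?k (c, regression_square \<rho> s c g q)
      \<partial>chi_square n \<partial>std_normal \<partial>chi_square (Suc n))"
    by (subst insert.IH) (simp_all add: n del: chi_square.simps)
  \<comment> \<open>Bring the integrals over \<open>g\<close> and \<open>h\<close>, which get rotated, next to each other.\<close>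
  also have "\<dots> = (\<integral>\<^sup>+c. \<integral>\<^sup>+x. \<integral>\<^sup>+q. \<integral>\<^sup>+g. \<integral>\<^sup>+h. f (c + x\<^sup>2, regression_square \<rho> s c g q + (\<rho> * x + s * h)\<^sup>2)
      \<partial>std_normal \<partial>std_normal \<partial>chi_square n \<partial>std_normal \<partial>chi_square (Suc n))"
  proof (rule nn_integral_cong)
    fix c :: real
    let ?f = "\<lambda>g q x h. f (c + x\<^sup>2, regression_square \<rho> s c g q + (\<rho> * x + s * h)\<^sup>2)"
    have "(\<integral>\<^sup>+g. \<integral>\<^sup>+q. \<integral>\<^sup>+x. \<integral>\<^sup>+h. ?f g q x h \<partial>std_normal \<partial>std_normal \<partial>chi_square n \<partial>std_normal) =
        (\<integral>\<^sup>+q. \<integral>\<^sup>+g. \<integral>\<^sup>+x. \<integral>\<^sup>+h. ?f g q x h \<partial>std_normal \<partial>std_normal \<partial>std_normal \<partial>chi_square n)"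
      by (rule Fub) measurable
    also have "\<dots> = (\<integral>\<^sup>+q. \<integral>\<^sup>+x. \<integral>\<^sup>+g. \<integral>\<^sup>+h. ?f g q x h \<partial>std_normal \<partial>std_normal \<partial>std_normal \<partial>chi_square n)"
      by (intro nn_integral_cong Fub) measurable
    also have "\<dots> = (\<integral>\<^sup>+x. \<integral>\<^sup>+q. \<integral>\<^sup>+g. \<integral>\<^sup>+h. ?f g q x h \<partial>std_normal \<partial>std_normal \<partial>chi_square n \<partial>std_normal)"
      by (rule Fub) measurable
    finally show "(\<integral>\<^sup>+g. \<integral>\<^sup>+q. ?k (c, regression_square \<rho> s c g q) \<partial>chi_square n \<partial>std_normal) =
        (\<integral>\<^sup>+x. \<integral>\<^sup>+q. \<integral>\<^sup>+g. \<integral>\<^sup>+h. ?f g q x h \<partial>std_normal \<partial>std_normal \<partial>chi_square n \<partial>std_normal)"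
      by simp
  qed
  also have "\<dots> = (\<integral>\<^sup>+c. \<integral>\<^sup>+x. \<integral>\<^sup>+q. \<integral>\<^sup>+g. \<integral>\<^sup>+h. f (c + x\<^sup>2, regression_square \<rho> s (c + x\<^sup>2) g (q + h\<^sup>2))
      \<partial>std_normal \<partial>std_normal \<partial>chi_square n \<partial>std_normal \<partial>chi_square (Suc n))"
  proof (rule nn_integral_chi_square_cong)
    fix c :: real assume c: "c \<ge> 0"
    show "(\<integral>\<^sup>+x. \<integral>\<^sup>+q. \<integral>\<^sup>+g. \<integral>\<^sup>+h. f (c + x\<^sup>2, regression_square \<rho> s c g q + (\<rho> * x + s * h)\<^sup>2)
        \<partial>std_normal \<partial>std_normal \<partial>chi_square n \<partial>std_normal) =
      (\<integral>\<^sup>+x. \<integral>\<^sup>+q. \<integral>\<^sup>+g. \<integral>\<^sup>+h. f (c + x\<^sup>2, regression_square \<rho> s (c + x\<^sup>2) g (q + h\<^sup>2))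
        \<partial>std_normal \<partial>std_normal \<partial>chi_square n \<partial>std_normal)"
      by (simp only: add_pair_rotate[OF insert.prems c])
  qed measurable
  also have "\<dots> = (\<integral>\<^sup>+c. \<integral>\<^sup>+x. \<integral>\<^sup>+g. \<integral>\<^sup>+q. \<integral>\<^sup>+h. f (c + x\<^sup>2, regression_square \<rho> s (c + x\<^sup>2) g (q + h\<^sup>2))
      \<partial>std_normal \<partial>chi_square n \<partial>std_normal \<partial>std_normal \<partial>chi_square (Suc n))"
    by (intro nn_integral_cong Fub) measurable
  also have "\<dots> = (\<integral>\<^sup>+c. \<integral>\<^sup>+g. \<integral>\<^sup>+q. f (c, regression_square \<rho> s c g q)
      \<partial>chi_square (Suc n) \<partial>std_normal \<partial>chi_square (Suc (Suc n)))"
    by (simp add: nn_integral_chi_square_Suc del: chi_square.simps)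
  finally show ?case using insert.hyps by (simp add: n del: chi_square.simps)
qed

section \<open>Support of the chi-square law\<close>
lemma emeasure_std_normal_open_pos:
  assumes "open U" "x \<in> U"
  shows "emeasure std_normal U > 0"
proof -
  obtain e where e: "e > 0" "ball x e \<subseteq> U" using assms openE by blast
  have [measurable]: "U \<in> sets borel" using assms by auto
  have "emeasure std_normal U \<noteq> 0"
  proof
    assume "emeasure std_normal U = 0"
    then have "AE y in lborel. ennreal (std_normal_density y) * indicator U y = 0"
      by (simp add: emeasure_density nn_integral_0_iff_AE)
    moreover have "ennreal (std_normal_density y) \<noteq> 0" for y
      using normal_density_pos[of 1 0 y] by simp
    ultimately have "AE y in lborel. y \<notin> U"
      by (simp add: indicator_def)
    then have "AE y in lborel. y \<notin> {x - e<..<x + e}"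
      by eventually_elim (use e(2) in \<open>auto simp: ball_def dist_real_def subset_eq\<close>)
    then have "emeasure lborel {x - e<..<x + e} = 0"
      by (subst (asm) AE_iff_null_sets[symmetric]) auto
    then show False using e(1) by simp
  qed
  then show ?thesis by (simp add: zero_less_iff_neq_zero)
qed

text \<open>One new square already reaches every neighbourhood of \<open>v\<close>, while the other squares are small
  with positive probability; the latter is the same statement at \<open>0\<close> for fewer squares, or
  trivial for the point mass that belongs to no squares.\<close>
lemma chi_square_Suc_support:
  assumes "v \<ge> 0" "\<epsilon> > 0"
  shows "measure (chi_square (Suc n)) {c. \<bar>c - v\<bar> < \<epsilon>} > 0"
  using assms
proof (induction n arbitrary: v \<epsilon>)
  have step: "measure (chi_square (Suc n)) {c. \<bar>c - v\<bar> < \<epsilon>} > 0"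
    if "v \<ge> 0" "\<epsilon> > 0" and pos: "emeasure (chi_square n) {c. \<bar>c\<bar> < \<epsilon> / 2} > 0" for n v \<epsilon>
  proof -
    let ?A = "{c. \<bar>c\<bar> < \<epsilon> / 2}" and ?B = "{x. \<bar>x\<^sup>2 - v\<bar> < \<epsilon> / 2}"
    have "emeasure std_normal ?B > 0"
      by (rule emeasure_std_normal_open_pos[of _ "sqrt v"])
        (use that in \<open>auto intro!: open_Collect_less continuous_intros\<close>)
    with pos have "emeasure (chi_square n) ?A * emeasure std_normal ?B > 0"
      by (simp add: ennreal_zero_less_mult_iff)
    also have "emeasure (chi_square n) ?A * emeasure std_normal ?B =
        emeasure (chi_square n \<Otimes>\<^sub>M std_normal) (?A \<times> ?B)"
      by (rule std_normal.emeasure_pair_measure_Times[symmetric]) measurable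
    also have "\<dots> \<le> emeasure (chi_square n \<Otimes>\<^sub>M std_normal)
        ((\<lambda>(c, x). c + x\<^sup>2) -` {c. \<bar>c - v\<bar> < \<epsilon>} \<inter> space (chi_square n \<Otimes>\<^sub>M std_normal))"
    proof (rule emeasure_mono)
      show "?A \<times> ?B \<subseteq> (\<lambda>(c, x). c + x\<^sup>2) -` {c. \<bar>c - v\<bar> < \<epsilon>} \<inter> space (chi_square n \<Otimes>\<^sub>M std_normal)"
      proof (clarsimp simp: space_pair_measure)
        fix c x assume "\<bar>c\<bar> * 2 < \<epsilon>" "\<bar>x\<^sup>2 - v\<bar> * 2 < \<epsilon>"
        then show "\<bar>c + x\<^sup>2 - v\<bar> < \<epsilon>" by (smt (verit))
      qed
    qed (rule measurable_sets[where A=borel], measurable)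
    also have "\<dots> = emeasure (chi_square (Suc n)) {c. \<bar>c - v\<bar> < \<epsilon>}"
      by (simp add: emeasure_distr)
    finally show ?thesis
      by (simp add: chi_square.emeasure_eq_measure del: chi_square.simps)
  qed
  {
    case 0
    show ?case
      by (rule step[OF 0]) (use 0 in simp)
  next
    case (Suc n)
    show ?case
      by (rule step[OF Suc.prems])
        (use Suc.IH[of 0 "\<epsilon> / 2"] Suc.prems in
          \<open>simp add: chi_square.emeasure_eq_measure del: chi_square.simps\<close>)
  }
qed

section \<open>Uniqueness of the conditional law at a point\<close>
lemma weak_conv_m_distr:
  assumes "prob_space N" and [measurable]: "\<And>n. F n \<in> borel_measurable N" "G \<in> borel_measurable N"
    and lim: "\<And>\<omega>. (\<lambda>n. F n \<omega>) \<longlonglongrightarrow> G \<omega>"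
  shows "weak_conv_m (\<lambda>n. distr N borel (F n)) (distr N borel G)"
proof -
  interpret prob_space N by fact
  show ?thesis
  proof (rule integral_bdd_continuous_conv_imp_weak_conv)
    fix f :: "real \<Rightarrow> real"
    assume f: "\<And>x. isCont f x" "\<And>x. \<bar>f x\<bar> \<le> 1"
    then have [measurable]: "f \<in> borel_measurable borel"
      by (intro borel_measurable_continuous_onI continuous_at_imp_continuous_on) auto
    have "(\<lambda>n. \<integral>\<omega>. f (F n \<omega>) \<partial>N) \<longlonglongrightarrow> (\<integral>\<omega>. f (G \<omega>) \<partial>N)"
      by (rule integral_dominated_convergence[where w="\<lambda>_. 1"])
        (use f lim in \<open>auto intro!: isCont_tendsto_compose[of _ f]\<close>)
    then show "(\<lambda>n. integral\<^sup>L (distr N borel (F n)) f) \<longlonglongrightarrow> integral\<^sup>L (distr N borel G) f"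
      by (simp add: integral_distr)
  qed simp_all
qed

text \<open>For a fixed rational \<open>q\<close> the probabilities of \<open>{..q}\<close> are densities of the same measure, hence
  agree almost everywhere. Countably many exceptional sets may be discarded, and the values of a
  distribution function at the rationals determine it by right continuity.\<close>
lemma regular_cond_distr_AE_unique:
  assumes "prob_space M" and Z [measurable]: "Z \<in> borel_measurable M"
    and 1: "regular_cond_distr M Y Z \<kappa>1" and 2: "regular_cond_distr M Y Z \<kappa>2"
  shows "AE z in distr M borel Z. \<kappa>1 z = \<kappa>2 z"
proof -
  interpret prob_space M by fact
  interpret Z: prob_space "distr M borel Z" by (rule prob_space_distr) fact
  have meas: "\<kappa>1 \<in> borel \<rightarrow>\<^sub>M prob_algebra borel" "\<kappa>2 \<in> borel \<rightarrow>\<^sub>M prob_algebra borel"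
    using 1 2 by (auto simp: regular_cond_distr_def)
  note [measurable] = meas[THEN measurable_prob_algebraD]
  have real: "real_distribution (\<kappa>1 z)" "real_distribution (\<kappa>2 z)" for z
    using meas[THEN measurable_space, of z]
    by (auto simp: space_prob_algebra real_distribution_def real_distribution_axioms_def)
  have "AE z in distr M borel Z. \<forall>q::rat. emeasure (\<kappa>1 z) {..of_rat q} = emeasure (\<kappa>2 z) {..of_rat q}"
    unfolding AE_all_countable
  proof
    fix q :: rat
    show "AE z in distr M borel Z. emeasure (\<kappa>1 z) {..of_rat q} = emeasure (\<kappa>2 z) {..of_rat q}"
    proof (rule Z.density_unique2)
      fix A assume "A \<in> sets (distr M borel Z)"
      then show "(\<integral>\<^sup>+z\<in>A. emeasure (\<kappa>1 z) {..of_rat q} \<partial>distr M borel Z) =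
          (\<integral>\<^sup>+z\<in>A. emeasure (\<kappa>2 z) {..of_rat q} \<partial>distr M borel Z)"
        using 1 2 by (simp add: regular_cond_distr_def)
    qed measurable
  qed
  then show ?thesis
  proof eventually_elim
    fix z
    assume eq: "\<forall>q::rat. emeasure (\<kappa>1 z) {..of_rat q} = emeasure (\<kappa>2 z) {..of_rat q}"
    interpret K1: real_distribution "\<kappa>1 z" by (rule real)
    interpret K2: real_distribution "\<kappa>2 z" by (rule real)
    have "cdf (\<kappa>1 z) x = cdf (\<kappa>2 z) x" for x
    proof -
      have "(cdf (\<kappa>1 z) \<longlongrightarrow> cdf (\<kappa>1 z) x) (at_right x)" "(cdf (\<kappa>2 z) \<longlongrightarrow> cdf (\<kappa>2 z) x) (at_right x)"
        using K1.cdf_is_right_cont K2.cdf_is_right_cont by (auto simp: continuous_within)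
      moreover obtain r :: "nat \<Rightarrow> rat" where r: "\<And>n. x < of_rat (r n)" "\<And>n. of_rat (r n) < x + 1 / Suc n"
      proof -
        have "\<exists>q. x < of_rat q \<and> of_rat q < x + 1 / Suc n" for n
          using of_rat_dense[of x "x + 1 / Suc n"] by auto
        then show ?thesis using that by metis
      qed
      have "filterlim (\<lambda>n. of_rat (r n)) (at_right x) sequentially"
      proof (rule tendsto_imp_filterlim_at_right)
        show "(\<lambda>n. real_of_rat (r n)) \<longlonglongrightarrow> x"
        proof (rule tendsto_sandwich[of "\<lambda>_. x" _ _ "\<lambda>n. x + 1 / Suc n"])
          show "(\<lambda>n. x + 1 / real (Suc n)) \<longlonglongrightarrow> x"
            using tendsto_add[OF tendsto_const LIMSEQ_Suc[OF lim_1_over_n]] by auto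
        qed (use r in \<open>auto intro!: always_eventually less_imp_le\<close>)
      qed (use r in auto)
      ultimately have "(\<lambda>n. cdf (\<kappa>1 z) (of_rat (r n))) \<longlonglongrightarrow> cdf (\<kappa>1 z) x"
        "(\<lambda>n. cdf (\<kappa>2 z) (of_rat (r n))) \<longlonglongrightarrow> cdf (\<kappa>2 z) x"
        by (auto intro: filterlim_compose)
      moreover have "cdf (\<kappa>1 z) (of_rat q) = cdf (\<kappa>2 z) (of_rat q)" for q
        using eq by (simp add: cdf_def measure_def)
      ultimately show ?thesis using LIMSEQ_unique by auto
    qed
    then show "\<kappa>1 z = \<kappa>2 z" by (intro cdf_unique real) auto
  qed
qed

lemma weak_conv_m_unique:
  assumes "\<And>n. real_distribution (\<mu> n)" "real_distribution \<nu>1" "real_distribution \<nu>2"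
    and "weak_conv_m \<mu> \<nu>1" "weak_conv_m \<mu> \<nu>2"
  shows "\<nu>1 = \<nu>2"
proof (rule Levy_uniqueness)
  show "char \<nu>1 = char \<nu>2"
    using LIMSEQ_unique[OF levy_continuity1[OF assms(1,2,4)] levy_continuity1[OF assms(1,3,5)]]
    by (simp add: fun_eq_iff)
qed fact+

text \<open>Two versions agree at some point in every neighbourhood of \<open>v\<close>, because the law of \<open>Z\<close> gives
  each neighbourhood positive mass. Both values at \<open>v\<close> are then weak limits of one sequence.\<close>
lemma is_cond_law_unique:
  assumes "prob_space M" and Z [measurable]: "Z \<in> borel_measurable M"
    and 1: "is_cond_law M Y Z v \<nu>1" and 2: "is_cond_law M Y Z v \<nu>2"
  shows "\<nu>1 = \<nu>2"
proof -
  interpret prob_space M by fact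
  have pos: "measure M {\<omega> \<in> space M. \<bar>Z \<omega> - v\<bar> < \<epsilon>} > 0" if "\<epsilon> > 0" for \<epsilon>
    using 1 that by (auto simp: is_cond_law_def)
  obtain \<kappa>1 \<kappa>2 where \<kappa>: "regular_cond_distr M Y Z \<kappa>1" "regular_cond_distr M Y Z \<kappa>2"
    and \<nu>: "\<nu>1 = \<kappa>1 v" "\<nu>2 = \<kappa>2 v"
    and cont1: "\<And>s. s \<longlonglongrightarrow> v \<Longrightarrow> weak_conv_m (\<lambda>n. \<kappa>1 (s n)) (\<kappa>1 v)"
    and cont2: "\<And>s. s \<longlonglongrightarrow> v \<Longrightarrow> weak_conv_m (\<lambda>n. \<kappa>2 (s n)) (\<kappa>2 v)"
    using 1 2 unfolding is_cond_law_def by metis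
  have meas: "\<kappa>1 \<in> borel \<rightarrow>\<^sub>M prob_algebra borel" "\<kappa>2 \<in> borel \<rightarrow>\<^sub>M prob_algebra borel"
    using \<kappa> by (auto simp: regular_cond_distr_def)
  have real: "real_distribution (\<kappa>1 z)" "real_distribution (\<kappa>2 z)" for z
    using meas[THEN measurable_space, of z]
    by (auto simp: space_prob_algebra real_distribution_def real_distribution_axioms_def)
  have ae: "AE z in distr M borel Z. \<kappa>1 z = \<kappa>2 z"
    using regular_cond_distr_AE_unique[OF \<open>prob_space M\<close> Z \<kappa>] .
  have "\<exists>z. \<bar>z - v\<bar> < \<epsilon> \<and> \<kappa>1 z = \<kappa>2 z" if "\<epsilon> > 0" for \<epsilon>
  proof (rule ccontr)
    assume "\<not> ?thesis"
    with ae have "AE z in distr M borel Z. \<not> \<bar>z - v\<bar> < \<epsilon>"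
      by (auto elim: eventually_mono)
    then have "AE \<omega> in M. \<not> \<bar>Z \<omega> - v\<bar> < \<epsilon>"
      by (subst (asm) AE_distr_iff) auto
    then have "prob {\<omega> \<in> space M. \<bar>Z \<omega> - v\<bar> < \<epsilon>} = 0"
      by (subst (asm) AE_iff_measurable[OF _ refl]) (auto simp: emeasure_eq_measure)
    then show False using pos[OF that] by simp
  qed
  then have "\<exists>z. \<bar>z - v\<bar> < 1 / Suc n \<and> \<kappa>1 z = \<kappa>2 z" for n by simp
  then obtain z where z: "\<And>n. \<bar>z n - v\<bar> < 1 / Suc n" "\<And>n. \<kappa>1 (z n) = \<kappa>2 (z n)" by metis
  have "z \<longlonglongrightarrow> v"
  proof (subst tendsto_dist_iff, rule tendsto_sandwich[of "\<lambda>_. 0" _ _ "\<lambda>n. 1 / Suc n"])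
    show "(\<lambda>n. 1 / real (Suc n)) \<longlonglongrightarrow> 0" by (rule LIMSEQ_Suc[OF lim_1_over_n])
  qed (use z in \<open>auto simp: dist_real_def intro!: always_eventually less_imp_le\<close>)
  then show ?thesis
    using cont1[of z] cont2[of z] z(2) real unfolding \<nu>
    by (intro weak_conv_m_unique[of "\<lambda>n. \<kappa>1 (z n)"]) simp_all
qed

section \<open>Uniform stability of the normal distribution function\<close>
lemma std_normal_cdf_Lipschitz:
  assumes "x \<le> y"
  shows "cdf std_normal y - cdf std_normal x \<le> y - x"
proof (cases "x < y")
  case True
  have "std_normal_density t \<le> 1" for t
  proof -
    have "exp (- t\<^sup>2 / 2) \<le> 1" by simp
    also have "1 \<le> sqrt (2 * pi)" using pi_gt3 by (intro real_le_rsqrt) auto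
    finally show ?thesis by (simp add: std_normal_density_def)
  qed
  then have "(\<integral>\<^sup>+t. ennreal (std_normal_density t) * indicator {x<..y} t \<partial>lborel) \<le>
      (\<integral>\<^sup>+t. indicator {x<..y} t \<partial>lborel)"
    by (intro nn_integral_mono) (auto simp: indicator_def)
  then have "emeasure std_normal {x<..y} \<le> ennreal (y - x)"
    using True by (simp add: emeasure_density)
  then have "measure std_normal {x<..y} \<le> y - x"
    using True by (simp add: std_normal.emeasure_eq_measure)
  then show ?thesis by (simp add: std_normal.cdf_diff_eq[OF True])
qed (use assms in simp)

text \<open>If \<open>|t v R| \<le> \<delta>\<close>, the event \<open>X + t v R \<le> x\<close> lies between \<open>X \<le> x - \<delta>\<close> and \<open>X \<le> x + \<delta>\<close>, and
  these cost at most \<open>\<delta>\<close> each by the Lipschitz bound, whatever \<open>x\<close> is. Tightness of \<open>R\<close> makes the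
  exceptional event have probability below \<open>\<delta>\<close> once \<open>t v\<close> is small.\<close>
lemma std_normal_perturbation_uniform:
  fixes X R :: "'a \<Rightarrow> real" and t :: "'b \<Rightarrow> real"
  assumes "prob_space N" and [measurable]: "X \<in> borel_measurable N" "R \<in> borel_measurable N"
    and X: "distr N borel X = std_normal" and t: "(t \<longlongrightarrow> 0) F"
  shows "((\<lambda>v. SUP x. \<bar>measure N {\<omega> \<in> space N. X \<omega> + t v * R \<omega> \<le> x} - cdf std_normal x\<bar>) \<longlongrightarrow> 0) F"
proof -
  interpret prob_space N by fact
  let ?D = "\<lambda>v x. \<bar>prob {\<omega> \<in> space N. X \<omega> + t v * R \<omega> \<le> x} - cdf std_normal x\<bar>"
  have cdfX: "cdf std_normal x = prob {\<omega> \<in> space N. X \<omega> \<le> x}" for x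
    unfolding X[symmetric] cdf_def by (simp add: measure_distr vimage_def Int_def conj_commute)
  have bdd: "bdd_above (range (?D v))" for v
  proof (rule bdd_aboveI2)
    fix x
    show "?D v x \<le> 1 + 1"
      using prob_le_1[of "{\<omega> \<in> space N. X \<omega> + t v * R \<omega> \<le> x}"] measure_nonneg[of N]
        std_normal.cdf_bounded_prob[of x] std_normal.cdf_nonneg[of x]
      by (smt (verit))
  qed
  show ?thesis
  proof (rule tendstoI)
    fix e :: real assume e: "e > 0"
    define \<delta> where "\<delta> = e / 3"
    have \<delta>: "\<delta> > 0" using e by (simp add: \<delta>_def)
    interpret R: real_distribution "distr N borel (\<lambda>\<omega>. \<bar>R \<omega>\<bar>)" by simp
    have "\<forall>\<^sub>F K in at_top. cdf (distr N borel (\<lambda>\<omega>. \<bar>R \<omega>\<bar>)) K > 1 - \<delta>"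
      using \<delta> by (intro order_tendstoD[OF R.cdf_lim_at_top_prob]) auto
    then have "\<forall>\<^sub>F K in at_top. cdf (distr N borel (\<lambda>\<omega>. \<bar>R \<omega>\<bar>)) K > 1 - \<delta> \<and> K > 0"
      by (intro eventually_conj eventually_gt_at_top)
    then obtain K where K: "cdf (distr N borel (\<lambda>\<omega>. \<bar>R \<omega>\<bar>)) K > 1 - \<delta>" "K > 0"
      by (auto dest: eventually_happens)
    let ?bad = "{\<omega> \<in> space N. \<not> \<bar>R \<omega>\<bar> \<le> K}"
    have "prob {\<omega> \<in> space N. \<bar>R \<omega>\<bar> \<le> K} > 1 - \<delta>"
      using K(1) unfolding cdf_def by (simp add: measure_distr vimage_def Int_def conj_commute)
    then have bad: "prob ?bad < \<delta>" by (subst prob_neg) auto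
    have "\<forall>\<^sub>F v in F. \<bar>t v\<bar> < \<delta> / K"
      using tendstoD[OF t, of "\<delta> / K"] \<delta> K(2) by (simp add: dist_real_def)
    then show "\<forall>\<^sub>F v in F. dist (SUP x. ?D v x) 0 < e"
    proof eventually_elim
      fix v assume tv: "\<bar>t v\<bar> < \<delta> / K"
      have small: "\<bar>t v * R \<omega>\<bar> \<le> \<delta>" if "\<bar>R \<omega>\<bar> \<le> K" for \<omega>
      proof -
        have "\<bar>t v\<bar> * \<bar>R \<omega>\<bar> \<le> \<delta> / K * K" using that tv K(2) by (intro mult_mono) auto
        then show ?thesis using K(2) by (simp add: abs_mult)
      qed
      have "?D v x \<le> 2 * \<delta>" for x
      proof -
        have "prob {\<omega> \<in> space N. X \<omega> + t v * R \<omega> \<le> x} \<le> prob ({\<omega> \<in> space N. X \<omega> \<le> x + \<delta>} \<union> ?bad)"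
          using small by (intro finite_measure_mono) (fastforce simp: abs_le_iff)+
        also have "\<dots> \<le> prob {\<omega> \<in> space N. X \<omega> \<le> x + \<delta>} + prob ?bad"
          by (rule measure_Un_le) measurable
        finally have upper: "prob {\<omega> \<in> space N. X \<omega> + t v * R \<omega> \<le> x} \<le> cdf std_normal (x + \<delta>) + \<delta>"
          using bad by (simp add: cdfX)
        have "prob {\<omega> \<in> space N. X \<omega> \<le> x - \<delta>} \<le> prob ({\<omega> \<in> space N. X \<omega> + t v * R \<omega> \<le> x} \<union> ?bad)"
          using small by (intro finite_measure_mono) (fastforce simp: abs_le_iff)+
        also have "\<dots> \<le> prob {\<omega> \<in> space N. X \<omega> + t v * R \<omega> \<le> x} + prob ?bad"
          by (rule measure_Un_le) measurable
        finally have "cdf std_normal (x - \<delta>) - \<delta> \<le> prob {\<omega> \<in> space N. X \<omega> + t v * R \<omega> \<le> x}"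
          using bad by (simp add: cdfX)
        with upper show ?thesis
          using std_normal_cdf_Lipschitz[of x "x + \<delta>"] std_normal_cdf_Lipschitz[of "x - \<delta>" x] \<delta>
          by (simp add: abs_le_iff)
      qed
      then have "(SUP x. ?D v x) \<le> 2 * \<delta>" by (intro cSUP_least) auto
      moreover have "0 \<le> (SUP x. ?D v x)"
        using bdd by (intro cSUP_upper2[of _ _ 0]) auto
      ultimately show "dist (SUP x. ?D v x) 0 < e" using e by (simp add: \<delta>_def)
    qed
  qed
qed

section \<open>The law of a correlated Gaussian pair\<close>
lemma (in pair_sigma_finite)
  fixes f :: "'a \<Rightarrow> real" and g :: "'b \<Rightarrow> real"
  assumes f: "integrable M1 f" and g: "integrable M2 g"
  shows integrable_fst_times_snd: "integrable (M1 \<Otimes>\<^sub>M M2) (\<lambda>p. f (fst p) * g (snd p))" (is ?int)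
    and integral_fst_times_snd: "(\<integral>p. f (fst p) * g (snd p) \<partial>(M1 \<Otimes>\<^sub>M M2)) = (\<integral>x. f x \<partial>M1) * (\<integral>y. g y \<partial>M2)"
proof -
  have [measurable]: "f \<in> borel_measurable M1" "g \<in> borel_measurable M2" using f g by auto
  show ?int
  proof (rule Fubini_integrable)
    show "integrable M1 (\<lambda>x. \<integral>y. norm (f (fst (x, y)) * g (snd (x, y))) \<partial>M2)"
      using f by (simp add: abs_mult)
  qed (use g in auto)
  from integral_fst'[OF this]
  show "(\<integral>p. f (fst p) * g (snd p) \<partial>(M1 \<Otimes>\<^sub>M M2)) = (\<integral>x. f x \<partial>M1) * (\<integral>y. g y \<partial>M2)"
    by simp
qed

lemma std_normal_moments:
  "integrable std_normal (\<lambda>x. x)" "(\<integral>x. x \<partial>std_normal) = 0"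
  "integrable std_normal (\<lambda>x. x\<^sup>2)" "(\<integral>x. x\<^sup>2 \<partial>std_normal) = 1"
  using integrable_std_normal_distribution_moment[of 1] integral_std_normal_distribution_moment_odd[of 1]
    std_normal_distribution_even_moments[of 1]
  by (simp_all add: fact_numeral)

lemma std_normal_pair_affine_moments:
  fixes \<mu> \<nu> a b c d :: real
  shows "(\<integral>p. \<mu> + a * fst p + b * snd p \<partial>(std_normal \<Otimes>\<^sub>M std_normal)) = \<mu>" (is ?mean)
    and "(\<integral>p. (\<mu> + a * fst p + b * snd p) * (\<nu> + c * fst p + d * snd p) \<partial>(std_normal \<Otimes>\<^sub>M std_normal)) =
      \<mu> * \<nu> + a * c + b * d" (is ?prod)
proof -
  let ?P = "std_normal \<Otimes>\<^sub>M std_normal"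
  interpret P: pair_prob_space std_normal std_normal ..
  note int = std_normal_pair.integrable_fst_times_snd and eq = std_normal_pair.integral_fst_times_snd
  have 1: "integrable std_normal (\<lambda>x. 1)" by simp
  note m = std_normal_moments
  note ints = int[OF m(1) 1, simplified] int[OF 1 m(1), simplified] int[OF m(3) 1, simplified]
    int[OF 1 m(3), simplified] int[OF m(1) m(1)]
  have eqs: "(\<integral>p. fst p \<partial>?P) = 0" "(\<integral>p. snd p \<partial>?P) = 0" "(\<integral>p. (fst p)\<^sup>2 \<partial>?P) = 1"
      "(\<integral>p. (snd p)\<^sup>2 \<partial>?P) = 1" "(\<integral>p. fst p * snd p \<partial>?P) = 0"
    using eq[OF m(1) 1] eq[OF 1 m(1)] eq[OF m(3) 1] eq[OF 1 m(3)] eq[OF m(1) m(1)] m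
      std_normal.prob_space by simp_all
  have "(\<integral>p. \<mu> + (a * fst p + b * snd p) \<partial>?P) = \<mu>"
    using ints eqs P.prob_space by simp
  then show ?mean by (simp add: add.assoc)
  have "(\<lambda>p. (\<mu> + a * fst p + b * snd p) * (\<nu> + c * fst p + d * snd p)) =
      (\<lambda>p. \<mu> * \<nu> + ((\<mu> * c + \<nu> * a) * fst p + ((\<mu> * d + \<nu> * b) * snd p + ((a * c) * (fst p)\<^sup>2 +
        ((b * d) * (snd p)\<^sup>2 + (a * d + b * c) * (fst p * snd p))))))"
    by (simp add: fun_eq_iff algebra_simps power2_eq_square)
  then show ?prod
    using ints eqs P.prob_space by simp
qed

lemma borel_measure_eqI_nn_integral:
  assumes "sets M = sets borel" "sets N = sets borel"
    and eq: "\<And>f. f \<in> borel_measurable borel \<Longrightarrow> (\<integral>\<^sup>+x. f x \<partial>M) = (\<integral>\<^sup>+x. f x \<partial>N)"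
  shows "M = N"
proof (rule measure_eqI)
  fix A assume "A \<in> sets M"
  then show "emeasure M A = emeasure N A"
    using eq[of "indicator A"] assms by (simp add: nn_integral_indicator)
qed (use assms in simp)

text \<open>The moments force the pair to be a linear image of \<open>(z, w)\<close> with rows \<open>(a, b)\<close> and \<open>(c, d)\<close> of
  length one and inner product \<open>\<rho>\<close>. Hence \<open>(c, d) = \<rho> (a, b) + D (- b, a)\<close>, where \<open>D\<close> is the
  determinant, and rotating \<open>(z, w)\<close> to the orthonormal frame \<open>(a, b)\<close>, \<open>(- b, a)\<close> gives the
  regression form. As \<open>D\<close> equals \<open>sqrt (1 - \<rho>\<^sup>2)\<close> up to sign, a reflection finishes the proof.\<close>
lemma correlated_gaussian_law:
  assumes "prob_space M" and biv: "bivariate_gaussian M (\<lambda>\<omega>. (U \<omega>, V \<omega>))"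
    and U: "standard_gaussian M U" and V: "standard_gaussian M V"
    and corr: "correlation M U V = \<rho>"
  shows "distr M borel (\<lambda>\<omega>. (U \<omega>, V \<omega>)) = regression_pair \<rho> (sqrt (1 - \<rho>\<^sup>2))"
proof -
  interpret prob_space M by fact
  interpret P: pair_prob_space std_normal std_normal ..
  let ?P = "std_normal \<Otimes>\<^sub>M std_normal"
  have [measurable]: "U \<in> borel_measurable M" "V \<in> borel_measurable M"
    and law: "distr M borel U = std_normal" "distr M borel V = std_normal"
    using U V by (auto simp: standard_gaussian_def distributed_def cong: distr_cong)
  obtain \<mu> \<nu> a b c d where biv_law: "distr M borel (\<lambda>\<omega>. (U \<omega>, V \<omega>)) =
      distr ?P borel (\<lambda>(z, w). (\<mu> + a * z + b * w, \<nu> + c * z + d * w))"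
    using biv[unfolded bivariate_gaussian_def, THEN conjunct2] by (elim exE)
  have *: "(\<integral>\<omega>. k (U \<omega>) \<partial>M) = (\<integral>x. k x \<partial>std_normal)" "(\<integral>\<omega>. k (V \<omega>) \<partial>M) = (\<integral>x. k x \<partial>std_normal)"
    if [measurable]: "k \<in> borel_measurable borel" for k :: "real \<Rightarrow> real"
  proof -
    have "(\<integral>x. k x \<partial>distr M borel U) = (\<integral>\<omega>. k (U \<omega>) \<partial>M)" "(\<integral>x. k x \<partial>distr M borel V) = (\<integral>\<omega>. k (V \<omega>) \<partial>M)"
      by (simp_all add: integral_distr)
    then show "(\<integral>\<omega>. k (U \<omega>) \<partial>M) = (\<integral>x. k x \<partial>std_normal)" "(\<integral>\<omega>. k (V \<omega>) \<partial>M) = (\<integral>x. k x \<partial>std_normal)"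
      unfolding law by simp_all
  qed
  note m = std_normal_moments
  have marg: "(\<integral>\<omega>. U \<omega> \<partial>M) = 0" "(\<integral>\<omega>. V \<omega> \<partial>M) = 0" "(\<integral>\<omega>. U \<omega> * U \<omega> \<partial>M) = 1" "(\<integral>\<omega>. V \<omega> * V \<omega> \<partial>M) = 1"
    using trans[OF *(1)[of "\<lambda>x. x"] m(2)] trans[OF *(2)[of "\<lambda>x. x"] m(2)]
      trans[OF *(1)[of "\<lambda>x. x\<^sup>2"] m(4)] trans[OF *(2)[of "\<lambda>x. x\<^sup>2"] m(4)]
    unfolding power2_eq_square by measurable
  have transfer: "(\<integral>\<omega>. k (U \<omega>, V \<omega>) \<partial>M) = (\<integral>p. k (\<mu> + a * fst p + b * snd p, \<nu> + c * fst p + d * snd p) \<partial>?P)"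
    if [measurable]: "k \<in> borel_measurable borel" for k :: "real \<times> real \<Rightarrow> real"
    using arg_cong[OF biv_law, of "\<lambda>M. integral\<^sup>L M k"]
    by (simp add: integral_distr split_beta')
  have cov: "(\<integral>\<omega>. U \<omega> * V \<omega> \<partial>M) = \<rho>"
    using corr by (simp add: correlation_def covariance_def marg)
  have "\<mu> = 0" "\<nu> = 0"
    using marg transfer[of fst] transfer[of snd] by (simp_all add: std_normal_pair_affine_moments)
  then have ab: "a\<^sup>2 + b\<^sup>2 = 1" and cd: "c\<^sup>2 + d\<^sup>2 = 1" and rho: "a * c + b * d = \<rho>"
    using marg cov transfer[of "\<lambda>p. fst p * fst p"] transfer[of "\<lambda>p. snd p * snd p"] transfer[of "\<lambda>p. fst p * snd p"]
      std_normal_pair_affine_moments(2)[of 0 a b 0 a b] std_normal_pair_affine_moments(2)[of 0 c d 0 c d]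
      std_normal_pair_affine_moments(2)[of 0 a b 0 c d]
    by (simp_all add: power2_eq_square)
  define D where "D = a * d - b * c"
  have "\<rho>\<^sup>2 + D\<^sup>2 = (a\<^sup>2 + b\<^sup>2) * (c\<^sup>2 + d\<^sup>2)"
    unfolding D_def rho[symmetric] by algebra
  then have "D\<^sup>2 = 1 - \<rho>\<^sup>2" by (simp add: ab cd)
  then have D: "sqrt (1 - \<rho>\<^sup>2) = \<bar>D\<bar>" by (metis real_sqrt_abs)
  have cd_eq: "c = \<rho> * a - D * b" "d = \<rho> * b + D * a"
  proof -
    have "\<rho> * a - D * b = (a\<^sup>2 + b\<^sup>2) * c" "\<rho> * b + D * a = (a\<^sup>2 + b\<^sup>2) * d"
      unfolding D_def rho[symmetric] by algebra+
    then show "c = \<rho> * a - D * b" "d = \<rho> * b + D * a" by (simp_all add: ab)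
  qed
  define \<sigma> :: real where "\<sigma> = (if D \<ge> 0 then 1 else - 1)"
  show ?thesis
  proof (rule borel_measure_eqI_nn_integral)
    fix f :: "real \<times> real \<Rightarrow> ennreal" assume [measurable]: "f \<in> borel_measurable borel"
    have "(\<integral>\<^sup>+y. f y \<partial>distr M borel (\<lambda>\<omega>. (U \<omega>, V \<omega>))) =
        (\<integral>\<^sup>+z. \<integral>\<^sup>+w. f (a * z + b * w, c * z + d * w) \<partial>std_normal \<partial>std_normal)"
      by (simp add: biv_law nn_integral_distr std_normal.nn_integral_fst[symmetric] split_beta' \<open>\<mu> = 0\<close> \<open>\<nu> = 0\<close>)
    also have "\<dots> = (\<integral>\<^sup>+z. \<integral>\<^sup>+w. (\<lambda>p. f (fst p, \<rho> * fst p + D * snd p)) (a * z + b * w, a * w - b * z)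
        \<partial>std_normal \<partial>std_normal)"
      by (simp add: cd_eq algebra_simps)
    also have "\<dots> = (\<integral>\<^sup>+x. \<integral>\<^sup>+h. f (x, \<rho> * x + D * h) \<partial>std_normal \<partial>std_normal)"
      by (subst nn_integral_std_normal_rotate[OF _ ab]) simp_all
    also have "\<dots> = (\<integral>\<^sup>+x. \<integral>\<^sup>+h. (\<lambda>h. f (x, \<rho> * x + sqrt (1 - \<rho>\<^sup>2) * h)) (\<sigma> * h) \<partial>std_normal \<partial>std_normal)"
      unfolding D by (simp add: \<sigma>_def)
    also have "\<dots> = (\<integral>\<^sup>+x. \<integral>\<^sup>+h. f (x, \<rho> * x + sqrt (1 - \<rho>\<^sup>2) * h) \<partial>std_normal \<partial>std_normal)"
      by (intro nn_integral_cong nn_integral_std_normal_reflect) (simp_all add: \<sigma>_def)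
    finally show "(\<integral>\<^sup>+y. f y \<partial>distr M borel (\<lambda>\<omega>. (U \<omega>, V \<omega>))) =
        (\<integral>\<^sup>+y. f y \<partial>regression_pair \<rho> (sqrt (1 - \<rho>\<^sup>2)))"
      by (simp add: nn_integral_regression_pair)
  qed simp_all
qed

section \<open>The conditional law of the second sum given the first\<close>

text \<open>In the application \<open>\<phi>\<close> standardises the second sum. The square root is continuous
  and odd on the whole line, so the formula defines a weakly continuous kernel there, including the
  negative \<open>z\<close> that carry no mass.\<close>
definition regression_kernel :: "real \<Rightarrow> real \<Rightarrow> nat \<Rightarrow> (real \<Rightarrow> real) \<Rightarrow> real \<Rightarrow> real measure" where
  "regression_kernel \<rho> s n \<phi> z =
    distr (std_normal \<Otimes>\<^sub>M chi_square n) borel (\<lambda>p. \<phi> (regression_square \<rho> s z (fst p) (snd p)))"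

lemma std_normal_chi_square_pair: "pair_prob_space std_normal (chi_square n)" ..

lemma emeasure_regression_kernel:
  assumes [measurable]: "\<phi> \<in> borel_measurable borel" "B \<in> sets borel"
  shows "emeasure (regression_kernel \<rho> s n \<phi> z) B =
    (\<integral>\<^sup>+g. \<integral>\<^sup>+q. indicator B (\<phi> (regression_square \<rho> s z g q)) \<partial>chi_square n \<partial>std_normal)"
proof -
  interpret pair_prob_space std_normal "chi_square n" by (rule std_normal_chi_square_pair)
  have "emeasure (regression_kernel \<rho> s n \<phi> z) B = (\<integral>\<^sup>+y. indicator B y \<partial>regression_kernel \<rho> s n \<phi> z)"
    by (simp add: regression_kernel_def)
  also have "\<dots> = (\<integral>\<^sup>+p. indicator B (\<phi> (regression_square \<rho> s z (fst p) (snd p))) \<partial>(std_normal \<Otimes>\<^sub>M chi_square n))"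
    unfolding regression_kernel_def by (rule nn_integral_distr) measurable
  also have "\<dots> = (\<integral>\<^sup>+g. \<integral>\<^sup>+q. indicator B (\<phi> (regression_square \<rho> s z g q)) \<partial>chi_square n \<partial>std_normal)"
    by (subst chi_square.nn_integral_fst[symmetric]) simp_all
  finally show ?thesis .
qed

lemma measurable_regression_kernel:
  assumes [measurable]: "\<phi> \<in> borel_measurable borel"
  shows "regression_kernel \<rho> s n \<phi> \<in> borel \<rightarrow>\<^sub>M prob_algebra borel"
proof -
  interpret pair_prob_space std_normal "chi_square n" by (rule std_normal_chi_square_pair)
  have "(\<lambda>z. std_normal \<Otimes>\<^sub>M chi_square n) \<in> borel \<rightarrow>\<^sub>M prob_algebra (std_normal \<Otimes>\<^sub>M chi_square n)"
    by (intro measurable_const) (simp add: space_prob_algebra P.prob_space_axioms)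
  then show ?thesis
    unfolding regression_kernel_def[abs_def] by (rule measurable_distr_prob_space2) measurable
qed

lemma weak_conv_regression_kernel:
  assumes \<phi>: "continuous_on UNIV \<phi>" and s: "z \<longlonglongrightarrow> v"
  shows "weak_conv_m (\<lambda>k. regression_kernel \<rho> s n \<phi> (z k)) (regression_kernel \<rho> s n \<phi> v)"
proof -
  interpret pair_prob_space std_normal "chi_square n" by (rule std_normal_chi_square_pair)
  have [measurable]: "\<phi> \<in> borel_measurable borel" using \<phi> by (rule borel_measurable_continuous_onI)
  have "(\<lambda>k. \<phi> (regression_square \<rho> s (z k) g q)) \<longlonglongrightarrow> \<phi> (regression_square \<rho> s v g q)" for g q
    using \<phi> unfolding regression_square_def
    by (intro isCont_tendsto_compose[of _ \<phi>] tendsto_intros s)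
      (simp add: continuous_on_eq_continuous_at)
  then show ?thesis
    unfolding regression_kernel_def by (intro weak_conv_m_distr P.prob_space_axioms) measurable
qed

lemma cond_law_regression_kernel:
  fixes Z T :: "'a \<Rightarrow> real"
  assumes M: "prob_space M" and [measurable]: "Z \<in> borel_measurable M" "T \<in> borel_measurable M"
    and joint: "\<And>f. f \<in> borel_measurable borel \<Longrightarrow> (\<integral>\<^sup>+\<omega>. f (Z \<omega>, T \<omega>) \<partial>M) =
      (\<integral>\<^sup>+c. \<integral>\<^sup>+g. \<integral>\<^sup>+q. f (c, regression_square \<rho> s c g q) \<partial>chi_square n \<partial>std_normal \<partial>chi_square (Suc k))"
    and \<phi>: "continuous_on UNIV \<phi>" and v: "v \<ge> 0"
  shows "cond_law M (\<lambda>\<omega>. \<phi> (T \<omega>)) Z v = regression_kernel \<rho> s n \<phi> v"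
proof -
  interpret prob_space M by fact
  have [measurable]: "\<phi> \<in> borel_measurable borel" using \<phi> by (rule borel_measurable_continuous_onI)
  note [measurable] = measurable_regression_kernel[THEN measurable_prob_algebraD]
  have Z_law: "(\<integral>\<^sup>+\<omega>. h (Z \<omega>) \<partial>M) = (\<integral>\<^sup>+c. h c \<partial>chi_square (Suc k))"
    if [measurable]: "h \<in> borel_measurable borel" for h
    using joint[of "\<lambda>p. h (fst p)"] std_normal.emeasure_space_1 chi_square.emeasure_space_1[of n]
    by (simp del: chi_square.simps)
  have kernel: "regular_cond_distr M (\<lambda>\<omega>. \<phi> (T \<omega>)) Z (regression_kernel \<rho> s n \<phi>)"
    unfolding regular_cond_distr_def
  proof (intro conjI ballI)
    show "regression_kernel \<rho> s n \<phi> \<in> borel \<rightarrow>\<^sub>M prob_algebra borel"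
      by (rule measurable_regression_kernel) measurable
    fix A B :: "real set" assume [measurable]: "A \<in> sets borel" "B \<in> sets borel"
    have "emeasure M {\<omega> \<in> space M. Z \<omega> \<in> A \<and> \<phi> (T \<omega>) \<in> B} =
        (\<integral>\<^sup>+\<omega>. indicator {\<omega> \<in> space M. Z \<omega> \<in> A \<and> \<phi> (T \<omega>) \<in> B} \<omega> \<partial>M)"
      by (rule nn_integral_indicator[symmetric]) measurable
    also have "\<dots> = (\<integral>\<^sup>+\<omega>. (\<lambda>p. indicator A (fst p) * indicator B (\<phi> (snd p))) (Z \<omega>, T \<omega>) \<partial>M)"
      by (intro nn_integral_cong) (simp add: indicator_def)
    also have "\<dots> = (\<integral>\<^sup>+c. \<integral>\<^sup>+g. \<integral>\<^sup>+q. indicator A c * indicator B (\<phi> (regression_square \<rho> s c g q))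
        \<partial>chi_square n \<partial>std_normal \<partial>chi_square (Suc k))"
      by (subst joint) (simp_all del: chi_square.simps)
    also have "\<dots> = (\<integral>\<^sup>+c. emeasure (regression_kernel \<rho> s n \<phi> c) B * indicator A c \<partial>chi_square (Suc k))"
      by (simp add: nn_integral_cmult emeasure_regression_kernel mult.commute del: chi_square.simps)
    also have "\<dots> = (\<integral>\<^sup>+\<omega>. emeasure (regression_kernel \<rho> s n \<phi> (Z \<omega>)) B * indicator A (Z \<omega>) \<partial>M)"
      by (rule Z_law[symmetric]) measurable
    also have "\<dots> = (\<integral>\<^sup>+z\<in>A. emeasure (regression_kernel \<rho> s n \<phi> z) B \<partial>distr M borel Z)"
      by (rule nn_integral_distr[symmetric]) measurable
    finally show "emeasure M {\<omega> \<in> space M. Z \<omega> \<in> A \<and> \<phi> (T \<omega>) \<in> B} =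
        (\<integral>\<^sup>+z\<in>A. emeasure (regression_kernel \<rho> s n \<phi> z) B \<partial>distr M borel Z)" .
  qed
  have support: "measure M {\<omega> \<in> space M. \<bar>Z \<omega> - v\<bar> < \<epsilon>} > 0" if "\<epsilon> > 0" for \<epsilon>
  proof -
    have "emeasure M {\<omega> \<in> space M. \<bar>Z \<omega> - v\<bar> < \<epsilon>} = (\<integral>\<^sup>+\<omega>. indicator {\<omega> \<in> space M. \<bar>Z \<omega> - v\<bar> < \<epsilon>} \<omega> \<partial>M)"
      by (rule nn_integral_indicator[symmetric]) measurable
    also have "\<dots> = (\<integral>\<^sup>+\<omega>. indicator {c. \<bar>c - v\<bar> < \<epsilon>} (Z \<omega>) \<partial>M)"
      by (intro nn_integral_cong) (simp add: indicator_def)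
    also have "\<dots> = emeasure (chi_square (Suc k)) {c. \<bar>c - v\<bar> < \<epsilon>}"
      by (subst Z_law) (simp_all del: chi_square.simps)
    finally show ?thesis
      using chi_square_Suc_support[OF v that, of k] by (simp add: measure_def)
  qed
  have cond: "is_cond_law M (\<lambda>\<omega>. \<phi> (T \<omega>)) Z v (regression_kernel \<rho> s n \<phi> v)"
    unfolding is_cond_law_def using support kernel weak_conv_regression_kernel[OF \<phi>] by blast
  then show ?thesis
    unfolding cond_law_def
    by (rule the_equality) (rule is_cond_law_unique[OF M \<open>Z \<in> borel_measurable M\<close> _ cond])
qed

lemma nn_integral_sum_squares_correlated_gaussians:
  fixes X1 X2 :: "nat \<Rightarrow> 'a \<Rightarrow> real"
  assumes "prob_space M" and J: "finite J" "J \<noteq> {}"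
    and biv: "\<And>i. i \<in> J \<Longrightarrow> bivariate_gaussian M (\<lambda>\<omega>. (X1 i \<omega>, X2 i \<omega>))"
    and X1: "\<And>i. i \<in> J \<Longrightarrow> standard_gaussian M (X1 i)"
    and X2: "\<And>i. i \<in> J \<Longrightarrow> standard_gaussian M (X2 i)"
    and corr: "\<And>i. i \<in> J \<Longrightarrow> correlation M (X1 i) (X2 i) = \<rho>"
    and indep: "prob_space.indep_vars M (\<lambda>_. borel) (\<lambda>i \<omega>. (X1 i \<omega>, X2 i \<omega>)) J"
    and [measurable]: "f \<in> borel_measurable borel"
  shows "(\<integral>\<^sup>+\<omega>. f (\<Sum>i\<in>J. (X1 i \<omega>)\<^sup>2, \<Sum>i\<in>J. (X2 i \<omega>)\<^sup>2) \<partial>M) =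
    (\<integral>\<^sup>+c. \<integral>\<^sup>+g. \<integral>\<^sup>+q. f (c, regression_square \<rho> (sqrt (1 - \<rho>\<^sup>2)) c g q)
      \<partial>chi_square (card J - 1) \<partial>std_normal \<partial>chi_square (card J))"
proof -
  interpret prob_space M by fact
  let ?E = "regression_pair \<rho> (sqrt (1 - \<rho>\<^sup>2))" and ?X = "\<lambda>i \<omega>. (X1 i \<omega>, X2 i \<omega>)"
  have meas: "random_variable borel (?X i)" if "i \<in> J" for i
    using biv[OF that] by (simp add: bivariate_gaussian_def)
  have "distr M (\<Pi>\<^sub>M i\<in>J. borel) (\<lambda>\<omega>. \<lambda>i\<in>J. ?X i \<omega>) = (\<Pi>\<^sub>M i\<in>J. distr M borel (?X i))"
    using indep_vars_iff_distr_eq_PiM'[OF J(2), of ?X "\<lambda>_. borel"] meas indep by blast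
  also have "\<dots> = Pi\<^sub>M J (\<lambda>_. ?E)"
    by (intro PiM_cong refl correlated_gaussian_law[OF \<open>prob_space M\<close> biv X1 X2 corr])
  finally have law: "distr M (\<Pi>\<^sub>M i\<in>J. borel) (\<lambda>\<omega>. \<lambda>i\<in>J. ?X i \<omega>) = Pi\<^sub>M J (\<lambda>_. ?E)" .
  have [measurable]: "(\<lambda>\<omega>. \<lambda>i\<in>J. ?X i \<omega>) \<in> M \<rightarrow>\<^sub>M (\<Pi>\<^sub>M i\<in>J. borel)"
    using meas by (intro measurable_restrict)
  let ?F = "\<lambda>p. f (\<Sum>i\<in>J. (fst (p i))\<^sup>2, \<Sum>i\<in>J. (snd (p i))\<^sup>2)"
  have "(\<integral>\<^sup>+\<omega>. f (\<Sum>i\<in>J. (X1 i \<omega>)\<^sup>2, \<Sum>i\<in>J. (X2 i \<omega>)\<^sup>2) \<partial>M) = (\<integral>\<^sup>+\<omega>. ?F (\<lambda>i\<in>J. ?X i \<omega>) \<partial>M)"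
    by simp
  also have "\<dots> = (\<integral>\<^sup>+p. ?F p \<partial>distr M (\<Pi>\<^sub>M i\<in>J. borel) (\<lambda>\<omega>. \<lambda>i\<in>J. ?X i \<omega>))"
    by (rule nn_integral_distr[symmetric]) measurable
  also have "\<dots> = (\<integral>\<^sup>+p. ?F p \<partial>Pi\<^sub>M J (\<lambda>_. ?E))"
    by (simp only: law)
  finally show ?thesis
    using nn_integral_sum_squares_regression[OF J, of f] by simp
qed

section \<open>Normal approximation of the conditional law\<close>
theorem mainTheorem3:
  fixes m :: nat and \<rho> :: real
    and M :: "'a measure" and X1 X2 :: "nat \<Rightarrow> 'a \<Rightarrow> real"
    and \<zeta>1 \<zeta>2 :: "'a \<Rightarrow> real"
    and N :: "real \<Rightarrow> 'b measure" and \<zeta>s :: "real \<Rightarrow> 'b \<Rightarrow> real"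
    and P :: "'c measure" and W :: "'c \<Rightarrow> real"
  assumes "m \<ge> 2"
    and "\<rho> \<in> {-1<..<1} - {0}"
    and "prob_space M"
    and "\<And>i. i \<in> {1..m} \<Longrightarrow> bivariate_gaussian M (\<lambda>\<omega>. (X1 i \<omega>, X2 i \<omega>))"
    and "\<And>i. i \<in> {1..m} \<Longrightarrow> standard_gaussian M (X1 i)"
    and "\<And>i. i \<in> {1..m} \<Longrightarrow> standard_gaussian M (X2 i)"
    and "\<And>i. i \<in> {1..m} \<Longrightarrow> correlation M (X1 i) (X2 i) = \<rho>"
    and "prob_space.indep_vars M (\<lambda>_. borel) (\<lambda>i \<omega>. (X1 i \<omega>, X2 i \<omega>)) {1..m}"
    and "\<zeta>1 = (\<lambda>\<omega>. \<Sum>i = 1..m. (X1 i \<omega>)\<^sup>2)"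
    and "\<zeta>2 = (\<lambda>\<omega>. \<Sum>i = 1..m. (X2 i \<omega>)\<^sup>2)"
    and "\<And>v. v > 0 \<Longrightarrow> prob_space (N v)"
    and "\<And>v. v > 0 \<Longrightarrow> \<zeta>s v \<in> borel_measurable (N v)"
    and "\<And>v. v > 0 \<Longrightarrow> distr (N v) borel (\<zeta>s v) =
           cond_law M (\<lambda>\<omega>. (\<zeta>2 \<omega> - \<rho>\<^sup>2 * v) / (2 * \<rho> * sqrt ((1 - \<rho>\<^sup>2) * v))) \<zeta>1 v"
    and "prob_space P"
    and "standard_gaussian P W"
  shows "((\<lambda>v. SUP x :: real.
            \<bar>measure (N v) {\<omega> \<in> space (N v). \<zeta>s v \<omega> \<le> x} -
             measure P {\<omega> \<in> space P. W \<omega> \<le> x}\<bar>) \<longlongrightarrow> 0) at_top"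
proof -
  interpret M: prob_space M by fact
  interpret Q: pair_prob_space std_normal "chi_square (m - 1)" by (rule std_normal_chi_square_pair)
  let ?Q = "std_normal \<Otimes>\<^sub>M chi_square (m - 1)"
  define s where "s = sqrt (1 - \<rho>\<^sup>2)"
  have \<rho>: "\<rho> \<noteq> 0" "\<rho>\<^sup>2 < 1" using assms(2) by (auto simp: abs_square_less_1)
  then have s: "s > 0" by (simp add: s_def)
  have [measurable]: "X1 i \<in> borel_measurable M" "X2 i \<in> borel_measurable M" if "i \<in> {1..m}" for i
    using assms(5,6)[OF that] by (auto simp: standard_gaussian_def distributed_def)
  have \<zeta>_meas: "\<zeta>1 \<in> borel_measurable M" "\<zeta>2 \<in> borel_measurable M"
    unfolding assms(9,10) by measurable
  have joint: "(\<integral>\<^sup>+\<omega>. f (\<zeta>1 \<omega>, \<zeta>2 \<omega>) \<partial>M) =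
      (\<integral>\<^sup>+c. \<integral>\<^sup>+g. \<integral>\<^sup>+q. f (c, regression_square \<rho> s c g q)
        \<partial>chi_square (m - 1) \<partial>std_normal \<partial>chi_square (Suc (m - 1)))"
    if "f \<in> borel_measurable borel" for f
    using nn_integral_sum_squares_correlated_gaussians[OF assms(3) _ _ assms(4-8) that] \<open>m \<ge> 2\<close>
    unfolding assms(9,10) s_def by (simp del: chi_square.simps)
  define t where "t v = s / (2 * \<rho> * sqrt v)" for v
  let ?R = "\<lambda>p. (fst p)\<^sup>2 + snd p"
  have law: "measure (N v) {\<omega> \<in> space (N v). \<zeta>s v \<omega> \<le> x} =
      measure ?Q {p \<in> space ?Q. fst p + t v * ?R p \<le> x}" if v: "v > 0" for v x
  proof -
    note [measurable] = assms(12)[OF v]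
    let ?\<phi> = "\<lambda>y. (y - \<rho>\<^sup>2 * v) / (2 * \<rho> * sqrt ((1 - \<rho>\<^sup>2) * v))"
    have den: "2 * \<rho> * sqrt ((1 - \<rho>\<^sup>2) * v) = 2 * \<rho> * s * sqrt v"
      by (simp add: s_def real_sqrt_mult)
    have "?\<phi> (regression_square \<rho> s v g q) = g + t v * (g\<^sup>2 + q)" for g q
      unfolding den regression_square_def t_def using \<rho> s v
      by (simp add: field_simps power2_eq_square)
    then have "distr (N v) borel (\<zeta>s v) = distr ?Q borel (\<lambda>p. fst p + t v * ?R p)"
      using cond_law_regression_kernel[OF assms(3) \<zeta>_meas joint, of ?\<phi> v] v \<rho>
      unfolding assms(13)[OF v] by (simp add: regression_kernel_def continuous_intros)
    then have "measure (distr (N v) borel (\<zeta>s v)) {..x} =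
        measure (distr ?Q borel (\<lambda>p. fst p + t v * ?R p)) {..x}"
      by simp
    then show ?thesis
      by (simp add: measure_distr vimage_def Int_def conj_commute)
  qed
  have W: "measure P {\<omega> \<in> space P. W \<omega> \<le> x} = cdf std_normal x" for x
  proof -
    have [measurable]: "W \<in> borel_measurable P" and "distr P borel W = std_normal"
      using assms(15) by (auto simp: standard_gaussian_def distributed_def cong: distr_cong)
    then have "cdf std_normal x = measure (distr P borel W) {..x}" by (simp add: cdf_def)
    then show ?thesis by (simp add: measure_distr vimage_def Int_def conj_commute)
  qed
  have "((\<lambda>v. s / (2 * \<rho>) * (1 / sqrt v)) \<longlongrightarrow> s / (2 * \<rho>) * 0) at_top"
    by (intro tendsto_mult tendsto_const tendsto_divide_0[OF tendsto_const]
        filterlim_at_top_imp_at_infinity sqrt_at_top)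
  then have "(t \<longlongrightarrow> 0) at_top" by (simp add: t_def[abs_def])
  moreover have "distr ?Q borel fst = std_normal"
    using chi_square.distr_pair_fst[of std_normal] by (simp cong: distr_cong)
  ultimately have "((\<lambda>v. SUP x. \<bar>measure ?Q {p \<in> space ?Q. fst p + t v * ?R p \<le> x} - cdf std_normal x\<bar>)
      \<longlongrightarrow> 0) at_top"
    by (intro std_normal_perturbation_uniform Q.P.prob_space_axioms) measurable
  then show ?thesis
    by (rule Lim_transform_eventually) (use eventually_gt_at_top[of 0] in eventually_elim, simp add: law W)
qed

end
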